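(* Consider an instance of LBMCF1 with unbounded demands: a directed graph $G=(V,E)$ with $|V|=n$, $|E|=m$, an edge capacity function $u:E\to\mathbb R_+$, origin-destination pairs $(s_i,t_i)$, $i=1,\dots,k$, and a length bound $L\in\mathbb Z^+$. Let $f^*$ be its optimal total flow value, and let $\varepsilon>0$ and $\delta>0$ be the parameters of Algorithm 1 (described in the context). (i) Algorithm 1 completes after $O\left(m\log_{1+\varepsilon}\frac{1+\varepsilon}{\delta}\right)$ augmentations. (ii) Given $\delta=\frac{1+\varepsilon}{\sqrt[\varepsilon]{(1+\varepsilon)L}}$, the feasible solution to LBMCF1 with unbounded demands found by Algorithm 1 has a total flow value $$g\ \ge\ \frac{f^*(1-\varepsilon)^2}{1+\varepsilon}.$$
   Context: **Problem.** $\mathbb R_+$ denotes the nonnegative reals and $\mathbb Z^+$ the positive integers. For each $i$, $\mathcal P_i(L)$ is the set of paths in $G$ from $s_i$ to $t_i$ with at most $L$ edges, and $\mathcal P(L)=\bigcup_{i=1}^k\mathcal P_i(L)$. LBMCF1 with unbounded demands (fractional length-bounded maximum multicommodity flow with unit edge-lengths) is the linear program: maximize $\sum_{P\in\mathcal P(L)}x(P)$ subject to $\sum_{P\in\mathcal P(L):\,e\in P}x(P)\le u(e)$ for all $e\in E$, and $x(P)\ge 0$ for all $P\in\mathcal P(L)$. Its optimal value is $f^*$; the total flow value of a solution $x$ is $\sum_{P\in\mathcal P(L)}x(P)$. **Standing assumptions (without loss of generality).** The pairs $(s_i,t_i)$ are pairwise distinct; each $\mathcal P_i(L)$ is nonempty.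 **Notation.** $S=\{s_1,\dots,s_k\}$; for $v\in S$, $T_v=\{t_i : s_i=v\}$. For edge lengths $\ell(e)$, $e\in E$, and a path $P$, $\ell(P)=\sum_{e\in P}\ell(e)$. A "shortest path" from $v$ to $v'\in T_v$ is a path from $v$ to $v'$ with at most $L$ edges minimizing $\ell(P)$ among all such paths, for the current $\ell$. **Algorithm 1** (parameters $\varepsilon,\delta$). Set $r_{\max}=\lfloor\log_{1+\varepsilon}\frac{1+\varepsilon}{\delta}\rfloor$, $\ell(e):=\delta$ for all $e\in E$, and $x(P):=0$ for all $P\in\mathcal P(L)$. For $r=1,\dots,r_{\max}$ do: for each $v\in S$ do: 1. find shortest paths $P(v')$ from $v$ to every $v'\in T_v$; let $P$ be one of these with smallest $\ell(P(v'))$; 2. while $\ell(P)<\min\{1,\delta(1+\varepsilon)^r\}$, perform an *augmentation*: let $u:=\min_{e\in P}u(e)$; set $\ell(e):=\ell(e)\left(1+\frac{\varepsilon u}{u(e)}\right)$ for all $e\in P$; set $x(P):=x(P)+u/\log_{1+\varepsilon}\frac{1+\varepsilon}{\delta}$; then recompute $P$ as in step 1 using the new $\ell$. The output is $x$.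
   Formalization: Part (ii) is stated for ε ≤ 1, since for ε > 1 it fails (a single path with L edges gets no augmentation, so g = 0 < bound); u/u(e) is read as 1 on a bottleneck edge of capacity zero, where it would be 0/0; origins differ from destinations; one O-constant serves all graphs up to isomorphism. *)

theory Defs
  imports "Graph_Theory.Arc_Walk" Complex_Main
begin

record ('a, 'b) lbmcf =
  network :: "('a, 'b) pre_digraph"
  capacity :: "'b \<Rightarrow> real"
  pairs :: nat
  source :: "nat \<Rightarrow> 'a"
  sink :: "nat \<Rightarrow> 'a"
  max_edges :: nat

definition bounded_paths :: "('a, 'b) lbmcf \<Rightarrow> 'a \<Rightarrow> 'a \<Rightarrow> 'b awalk set" where
  "bounded_paths I v w = {P. pre_digraph.apath (network I) v P w \<and> length P \<le> max_edges I}"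

definition all_paths :: "('a, 'b) lbmcf \<Rightarrow> 'b awalk set" where
  "all_paths I = (\<Union>i\<in>{1..pairs I}. bounded_paths I (source I i) (sink I i))"

text \<open>
  Without \<open>source I i \<noteq> sink I i\<close> the arc-free path would be admissible, and the
  linear program would be unbounded.
\<close>

definition lbmcf_instance :: "('a, 'b) lbmcf \<Rightarrow> bool" where
  "lbmcf_instance I \<longleftrightarrow>
     fin_digraph (network I) \<and>
     (\<forall>e\<in>arcs (network I). 0 \<le> capacity I e) \<and>
     0 < max_edges I \<and>
     (\<forall>i\<in>{1..pairs I}. source I i \<noteq> sink I i) \<and>
     inj_on (\<lambda>i. (source I i, sink I i)) {1..pairs I} \<and>
     (\<forall>i\<in>{1..pairs I}. bounded_paths I (source I i) (sink I i) \<noteq> {})"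

definition feasible :: "('a, 'b) lbmcf \<Rightarrow> ('b awalk \<Rightarrow> real) \<Rightarrow> bool" where
  "feasible I x \<longleftrightarrow>
     (\<forall>e\<in>arcs (network I). (\<Sum>P\<in>{P \<in> all_paths I. e \<in> set P}. x P) \<le> capacity I e) \<and>
     (\<forall>P\<in>all_paths I. 0 \<le> x P)"

definition flow_value :: "('a, 'b) lbmcf \<Rightarrow> ('b awalk \<Rightarrow> real) \<Rightarrow> real" where
  "flow_value I x = (\<Sum>P\<in>all_paths I. x P)"

definition optimal_value :: "('a, 'b) lbmcf \<Rightarrow> real" where
  "optimal_value I = (SUP x\<in>{x. feasible I x}. flow_value I x)"

definition sources :: "('a, 'b) lbmcf \<Rightarrow> 'a set" where
  "sources I = source I ` {1..pairs I}"

definition sinks_of :: "('a, 'b) lbmcf \<Rightarrow> 'a \<Rightarrow> 'a set" where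
  "sinks_of I v = {sink I i |i. i \<in> {1..pairs I} \<and> source I i = v}"

definition path_length :: "('b \<Rightarrow> real) \<Rightarrow> 'b awalk \<Rightarrow> real" where
  "path_length l P = (\<Sum>e\<in>set P. l e)"

text \<open>
  \<open>selectable I l v P\<close>: under some choice of shortest paths from \<open>v\<close> to its sinks,
  \<open>P\<close> is a shortest one among the chosen paths. Ties are broken arbitrarily.
\<close>

definition selectable :: "('a, 'b) lbmcf \<Rightarrow> ('b \<Rightarrow> real) \<Rightarrow> 'a \<Rightarrow> 'b awalk \<Rightarrow> bool" where
  "selectable I l v P \<longleftrightarrow>
     (\<exists>Q. (\<forall>w\<in>sinks_of I v. is_arg_min (path_length l) (\<lambda>R. R \<in> bounded_paths I v w) (Q w)) \<and>
          (\<exists>w. is_arg_min (\<lambda>w. path_length l (Q w)) (\<lambda>w. w \<in> sinks_of I v) w \<and> P = Q w))"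

definition bottleneck :: "('a, 'b) lbmcf \<Rightarrow> 'b awalk \<Rightarrow> real" where
  "bottleneck I P = Min (capacity I ` set P)"

text \<open>
  The quotient of the bottleneck capacity by \<open>capacity I e\<close>. Capacities may be zero;
  the quotient is 1 on every bottleneck arc, also if its capacity is zero, whereas
  HOL has \<open>0 / 0 = 0\<close>.
\<close>

definition capacity_ratio :: "('a, 'b) lbmcf \<Rightarrow> 'b awalk \<Rightarrow> 'b \<Rightarrow> real" where
  "capacity_ratio I P e =
     (if capacity I e = bottleneck I P then 1 else bottleneck I P / capacity I e)"

definition augment_lengths ::
    "('a, 'b) lbmcf \<Rightarrow> real \<Rightarrow> 'b awalk \<Rightarrow> ('b \<Rightarrow> real) \<Rightarrow> 'b \<Rightarrow> real" where
  "augment_lengths I \<epsilon> P l =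
     (\<lambda>e. if e \<in> set P then l e * (1 + \<epsilon> * capacity_ratio I P e) else l e)"

definition augment_flow ::
    "('a, 'b) lbmcf \<Rightarrow> real \<Rightarrow> real \<Rightarrow> 'b awalk \<Rightarrow> ('b awalk \<Rightarrow> real) \<Rightarrow> 'b awalk \<Rightarrow> real" where
  "augment_flow I \<epsilon> \<delta> P x =
     x(P := x P + bottleneck I P / log (1 + \<epsilon>) ((1 + \<epsilon>) / \<delta>))"

definition max_round :: "real \<Rightarrow> real \<Rightarrow> int" where
  "max_round \<epsilon> \<delta> = \<lfloor>log (1 + \<epsilon>) ((1 + \<epsilon>) / \<delta>)\<rfloor>"

text \<open>
  The algorithm as a nondeterministic transition system. In a configuration, \<open>pending\<close>
  holds the sources that the current round has not yet visited, \<open>active\<close> is the source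
  being processed, if any, and \<open>augmentations\<close> counts the augmentations so far.
\<close>

record ('a, 'b) config =
  current_round :: nat
  pending :: "'a set"
  active :: "'a option"
  lengths :: "'b \<Rightarrow> real"
  flow :: "'b awalk \<Rightarrow> real"
  augmentations :: nat

definition initial :: "real \<Rightarrow> ('a, 'b) config" where
  "initial \<delta> = \<lparr>current_round = 0, pending = {}, active = None,
     lengths = (\<lambda>_. \<delta>), flow = (\<lambda>_. 0), augmentations = 0\<rparr>"

inductive step ::
    "('a, 'b) lbmcf \<Rightarrow> real \<Rightarrow> real \<Rightarrow> ('a, 'b) config \<Rightarrow> ('a, 'b) config \<Rightarrow> bool"
  for I \<epsilon> \<delta> where
  next_round:
    "\<lbrakk>active c = None; pending c = {}; int (current_round c) < max_round \<epsilon> \<delta>\<rbrakk>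
     \<Longrightarrow> step I \<epsilon> \<delta> c (c\<lparr>current_round := current_round c + 1, pending := sources I\<rparr>)"
| enter_source:
    "\<lbrakk>active c = None; v \<in> pending c\<rbrakk>
     \<Longrightarrow> step I \<epsilon> \<delta> c (c\<lparr>pending := pending c - {v}, active := Some v\<rparr>)"
| augmentation:
    "\<lbrakk>active c = Some v; selectable I (lengths c) v P;
      path_length (lengths c) P < min 1 (\<delta> * (1 + \<epsilon>) ^ current_round c)\<rbrakk>
     \<Longrightarrow> step I \<epsilon> \<delta> c (c\<lparr>lengths := augment_lengths I \<epsilon> P (lengths c),
                           flow := augment_flow I \<epsilon> \<delta> P (flow c),
                           augmentations := augmentations c + 1\<rparr>)"
| leave_source:
    "\<lbrakk>active c = Some v; selectable I (lengths c) v P;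
      \<not> path_length (lengths c) P < min 1 (\<delta> * (1 + \<epsilon>) ^ current_round c)\<rbrakk>
     \<Longrightarrow> step I \<epsilon> \<delta> c (c\<lparr>active := None\<rparr>)"

definition reachable_config ::
    "('a, 'b) lbmcf \<Rightarrow> real \<Rightarrow> real \<Rightarrow> ('a, 'b) config \<Rightarrow> bool" where
  "reachable_config I \<epsilon> \<delta> c \<longleftrightarrow> (step I \<epsilon> \<delta>)\<^sup>*\<^sup>* (initial \<delta>) c"

definition completed :: "real \<Rightarrow> real \<Rightarrow> ('a, 'b) config \<Rightarrow> bool" where
  "completed \<epsilon> \<delta> c \<longleftrightarrow>
     active c = None \<and> pending c = {} \<and> max_round \<epsilon> \<delta> \<le> int (current_round c)"

text \<open>
  Every run completes: no run is infinite, and none gets stuck before completion.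
\<close>

definition always_completes :: "('a, 'b) lbmcf \<Rightarrow> real \<Rightarrow> real \<Rightarrow> bool" where
  "always_completes I \<epsilon> \<delta> \<longleftrightarrow>
     (\<nexists>c. c 0 = initial \<delta> \<and> (\<forall>j::nat. step I \<epsilon> \<delta> (c j) (c (Suc j)))) \<and>
     (\<forall>c. reachable_config I \<epsilon> \<delta> c \<longrightarrow> completed \<epsilon> \<delta> c \<or> (\<exists>c'. step I \<epsilon> \<delta> c c'))"

end

theory Submission
  imports Defs "HOL-Analysis.Convex"
begin

text \<open>An augmentation multiplies the length of a bottleneck arc by \<open>1 + \<epsilon>\<close>. Arc lengths start
  at \<open>\<delta>\<close> and stay below \<open>max \<delta> (1 + \<epsilon>)\<close>, so an arc is a bottleneck at most
  \<open>log (1 + \<epsilon>) ((1 + \<epsilon>) / \<delta>)\<close> times. The same bound gives feasibility: since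
  \<open>(1 + \<epsilon>) powr t \<le> 1 + \<epsilon> * t\<close> for \<open>t\<close> between 0 and 1, the length of an arc grows at least like
  \<open>1 + \<epsilon>\<close> to the power (unscaled flow through the arc) / (capacity of the arc).

  For the flow value, weak LP duality suffices. In round \<open>r\<close> every path has length at least
  \<open>min 1 (\<delta> * (1 + \<epsilon>) ^ (r - 1))\<close>, so an augmented path is shortest up to a factor \<open>1 + \<epsilon>\<close>.
  Weak duality for the length increases \<open>l - \<delta>\<close> then bounds the minimum path length by
  \<open>\<delta> * L * exp (\<epsilon> * (1 + \<epsilon>) * G / f)\<close>, where \<open>G\<close> is the unscaled flow value and \<open>f\<close> the optimal
  value. In the end this length is at least 1, which bounds \<open>G\<close> from below.\<close>

text \<open>Convexity of \<open>exp\<close>: on the segment from 0 to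
  \<open>ln (1 + \<epsilon>)\<close> its graph lies below the chord, whose height at weight
  \<open>t\<close> is \<open>1 + \<epsilon> * t\<close>.\<close>

lemma le_log_one_plus:
  fixes \<epsilon> t :: real
  assumes "0 < \<epsilon>" "0 \<le> t" "t \<le> 1"
  shows "t \<le> log (1 + \<epsilon>) (1 + \<epsilon> * t)"
proof -
  have "(1 + \<epsilon>) powr t = exp ((1 - t) *\<^sub>R 0 + t *\<^sub>R ln (1 + \<epsilon>))"
    using assms by (simp add: powr_def)
  also have "\<dots> \<le> (1 - t) * exp 0 + t * exp (ln (1 + \<epsilon>))"
    by (rule convex_onD[OF exp_convex]) (use assms in auto)
  also have "\<dots> = 1 + \<epsilon> * t"
    using assms by (simp add: algebra_simps)
  finally have "(1 + \<epsilon>) powr t \<le> 1 + \<epsilon> * t" .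
  moreover have "0 < 1 + \<epsilon> * t"
    using assms by (simp add: add_pos_nonneg)
  ultimately show ?thesis
    using assms by (simp add: le_log_iff)
qed

locale lbmcf_algorithm =
  fixes I :: "('a, 'b) lbmcf" and \<epsilon> \<delta> :: real
  assumes inst: "lbmcf_instance I" and eps_pos: "0 < \<epsilon>" and delta_pos: "0 < \<delta>"
begin

sublocale fin_digraph "network I"
  using inst by (simp add: lbmcf_instance_def)

abbreviation E :: "'b set" where "E \<equiv> arcs (network I)"

text \<open>Both the factor by which the algorithm scales flow down and the base
  \<open>1 + \<epsilon>\<close> logarithm of the range of an arc length from \<open>\<delta>\<close>
  to \<open>1 + \<epsilon>\<close>. That these agree makes the output feasible.\<close>

abbreviation K :: real where "K \<equiv> log (1 + \<epsilon>) ((1 + \<epsilon>) / \<delta>)"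

section \<open>Admissible paths and the selection of a shortest one\<close>

lemma capacity_nonneg: "e \<in> E \<Longrightarrow> 0 \<le> capacity I e"
  using inst by (simp add: lbmcf_instance_def)

lemma finite_bounded_paths: "finite (bounded_paths I v w)"
  unfolding bounded_paths_def by (rule finite_subset[OF _ apaths_finite[of v w]]) auto

lemma finite_all_paths: "finite (all_paths I)"
  unfolding all_paths_def by (intro finite_UN_I finite_bounded_paths) auto

lemma all_pathsD:
  assumes "P \<in> all_paths I"
  shows "set P \<subseteq> E" and "P \<noteq> []" and "length P \<le> max_edges I"
proof -
  from assms obtain i where i: "i \<in> {1..pairs I}" "P \<in> bounded_paths I (source I i) (sink I i)"
    unfolding all_paths_def by auto
  then have P: "awalk (source I i) P (sink I i)" and "length P \<le> max_edges I"
    by (auto simp: bounded_paths_def apath_def)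
  moreover have "source I i \<noteq> sink I i"
    using inst i(1) by (simp add: lbmcf_instance_def)
  ultimately show "set P \<subseteq> E" "P \<noteq> []" "length P \<le> max_edges I"
    by (auto simp: awalk_def)
qed

lemma all_pathsI:
  "i \<in> {1..pairs I} \<Longrightarrow> source I i = v \<Longrightarrow> P \<in> bounded_paths I v (sink I i) \<Longrightarrow> P \<in> all_paths I"
  by (auto simp: all_paths_def)

lemma selectable_in_all_paths:
  assumes "selectable I l v P"
  shows "P \<in> all_paths I"
  using assms by (fastforce simp: selectable_def is_arg_min_def sinks_of_def intro: all_pathsI)

text \<open>A minimum of the per-sink minima is a minimum over all sinks, so the tie-breaking choice
  \<open>Q\<close> disappears from the rest of the analysis.\<close>

lemma selectable_le:
  assumes "selectable I l v P" "i \<in> {1..pairs I}" "source I i = v"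
    and "R \<in> bounded_paths I v (sink I i)"
  shows "path_length l P \<le> path_length l R"
proof -
  from assms(1) obtain Q w where
    Q: "\<And>w. w \<in> sinks_of I v \<Longrightarrow>
          is_arg_min (path_length l) (\<lambda>R. R \<in> bounded_paths I v w) (Q w)"
    and w: "is_arg_min (\<lambda>w. path_length l (Q w)) (\<lambda>w. w \<in> sinks_of I v) w" "P = Q w"
    unfolding selectable_def by blast
  have i: "sink I i \<in> sinks_of I v"
    using assms by (auto simp: sinks_of_def)
  have "path_length l P \<le> path_length l (Q (sink I i))"
    using w i by (simp add: is_arg_min_linorder)
  also have "\<dots> \<le> path_length l R"
    using Q[OF i] assms(4) by (simp add: is_arg_min_linorder)
  finally show ?thesis .
qed

lemma ex_selectable:
  assumes "v \<in> sources I"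
  shows "\<exists>P. selectable I l v P"
proof -
  have "\<exists>R. is_arg_min (path_length l) (\<lambda>R. R \<in> bounded_paths I v w) R"
    if "w \<in> sinks_of I v" for w
  proof (rule ex_is_arg_min_if_finite[OF finite_bounded_paths])
    show "bounded_paths I v w \<noteq> {}"
      using that inst by (auto simp: sinks_of_def lbmcf_instance_def)
  qed
  then obtain Q where
    Q: "\<forall>w\<in>sinks_of I v. is_arg_min (path_length l) (\<lambda>R. R \<in> bounded_paths I v w) (Q w)"
    by metis
  have "sinks_of I v = sink I ` {i \<in> {1..pairs I}. source I i = v}"
    by (auto simp: sinks_of_def)
  then have "finite (sinks_of I v)" "sinks_of I v \<noteq> {}"
    using assms by (auto simp: sources_def)
  from ex_is_arg_min_if_finite[OF this, of "\<lambda>w. path_length l (Q w)"] Q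
  show ?thesis
    unfolding selectable_def by blast
qed

section \<open>Bottleneck arcs and the length update\<close>

lemma bottleneck_le: "P \<in> all_paths I \<Longrightarrow> e \<in> set P \<Longrightarrow> bottleneck I P \<le> capacity I e"
  by (simp add: bottleneck_def)

lemma bottleneck_attained:
  assumes "P \<in> all_paths I"
  obtains e where "e \<in> set P" "capacity I e = bottleneck I P"
proof -
  have "bottleneck I P \<in> capacity I ` set P"
    unfolding bottleneck_def using all_pathsD(2)[OF assms] by (intro Min_in) auto
  then show ?thesis
    using that by auto
qed

lemma bottleneck_nonneg: "P \<in> all_paths I \<Longrightarrow> 0 \<le> bottleneck I P"
  by (metis bottleneck_attained all_pathsD(1) capacity_nonneg subsetD)

lemma capacity_ratio_bounds:
  assumes "P \<in> all_paths I" "e \<in> set P"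
  shows "0 \<le> capacity_ratio I P e" "capacity_ratio I P e \<le> 1"
  using bottleneck_le[OF assms] bottleneck_nonneg[OF assms(1)]
  by (auto simp: capacity_ratio_def divide_simps)

text \<open>Covers zero capacities too: an arc of capacity 0 on \<open>P\<close> is a bottleneck, so
  its ratio is 1 and both sides vanish.\<close>

lemma capacity_times_ratio:
  assumes "P \<in> all_paths I" "e \<in> set P"
  shows "capacity I e * capacity_ratio I P e = bottleneck I P"
  using bottleneck_le[OF assms] bottleneck_nonneg[OF assms(1)]
  by (auto simp: capacity_ratio_def)

lemma augment_lengths_ge:
  assumes "P \<in> all_paths I" "0 \<le> l e"
  shows "l e \<le> augment_lengths I \<epsilon> P l e"
  using assms capacity_ratio_bounds[of P e] eps_pos
  by (auto simp: augment_lengths_def algebra_simps)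

text \<open>Turns the multiplicative update into an additive one; the count of augmentations and the
  feasibility bound both use this logarithmic potential.\<close>

lemma log_augment_lengths:
  assumes "P \<in> all_paths I" "e \<in> set P" "0 < l e"
  shows "log (1 + \<epsilon>) (augment_lengths I \<epsilon> P l e / \<delta>)
       = log (1 + \<epsilon>) (l e / \<delta>) + log (1 + \<epsilon>) (1 + \<epsilon> * capacity_ratio I P e)"
proof -
  have "0 < 1 + \<epsilon> * capacity_ratio I P e"
    using capacity_ratio_bounds[OF assms(1,2)] eps_pos by (simp add: add_pos_nonneg)
  then have "log (1 + \<epsilon>) ((l e / \<delta>) * (1 + \<epsilon> * capacity_ratio I P e))
       = log (1 + \<epsilon>) (l e / \<delta>) + log (1 + \<epsilon>) (1 + \<epsilon> * capacity_ratio I P e)"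
    using assms(3) delta_pos by (intro log_mult_pos) auto
  then show ?thesis
    using assms(2) by (simp add: augment_lengths_def)
qed

section \<open>Loop thresholds of the rounds\<close>

definition threshold :: "nat \<Rightarrow> real" where
  "threshold r = min 1 (\<delta> * (1 + \<epsilon>) ^ r)"

lemma threshold_mono: "r \<le> s \<Longrightarrow> threshold r \<le> threshold s"
  using eps_pos delta_pos unfolding threshold_def
  by (intro min.mono mult_left_mono power_increasing) auto

text \<open>Capping at 1 only helps. For \<open>r = 0\<close> truncated subtraction gives
  \<open>r - 1 = 0\<close>, and the claim is just that \<open>1 + \<epsilon>\<close> exceeds
  1.\<close>

lemma threshold_le: "threshold r \<le> (1 + \<epsilon>) * threshold (r - 1)"
  using eps_pos delta_pos
  by (cases r) (auto simp: threshold_def min_def mult.left_commute mult_le_cancel_left1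
      intro: order_trans)

text \<open>As \<open>max_round\<close> is the floor of \<open>K\<close>, such an \<open>r\<close>
  satisfies \<open>K < r + 1\<close>, that is
  \<open>1 < \<delta> * (1 + \<epsilon>) ^ r\<close>.\<close>

lemma threshold_eq_1:
  assumes "max_round \<epsilon> \<delta> \<le> int r"
  shows "threshold r = 1"
proof -
  have "K < real r + 1"
    using assms unfolding max_round_def by linarith
  then have "(1 + \<epsilon>) / \<delta> < (1 + \<epsilon>) powr (real r + 1)"
    using eps_pos delta_pos by (simp add: log_less_iff)
  also have "\<dots> = (1 + \<epsilon>) ^ r * (1 + \<epsilon>)"
    using eps_pos by (simp add: powr_add powr_realpow)
  finally have "1 < \<delta> * (1 + \<epsilon>) ^ r"
    using eps_pos delta_pos by (simp add: divide_simps mult.commute)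
  then show ?thesis
    by (simp add: threshold_def)
qed

section \<open>Invariants of runs\<close>

text \<open>Induction along runs that also supplies reachability of the predecessor, so invariants
  shown earlier can be used in the proofs of later ones.\<close>

lemma reachable_induct [consumes 1, case_names initial next_round enter augment leave]:
  assumes "reachable_config I \<epsilon> \<delta> c"
    and "\<Phi> (initial \<delta>)"
    and "\<And>c. \<lbrakk>reachable_config I \<epsilon> \<delta> c; \<Phi> c; active c = None; pending c = {}\<rbrakk>
           \<Longrightarrow> \<Phi> (c\<lparr>current_round := current_round c + 1, pending := sources I\<rparr>)"
    and "\<And>c v. \<lbrakk>reachable_config I \<epsilon> \<delta> c; \<Phi> c; active c = None; v \<in> pending c\<rbrakk>
           \<Longrightarrow> \<Phi> (c\<lparr>pending := pending c - {v}, active := Some v\<rparr>)"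
    and "\<And>c v P. \<lbrakk>reachable_config I \<epsilon> \<delta> c; \<Phi> c; active c = Some v;
             selectable I (lengths c) v P; P \<in> all_paths I;
             path_length (lengths c) P < threshold (current_round c)\<rbrakk>
           \<Longrightarrow> \<Phi> (c\<lparr>lengths := augment_lengths I \<epsilon> P (lengths c),
                     flow := augment_flow I \<epsilon> \<delta> P (flow c),
                     augmentations := augmentations c + 1\<rparr>)"
    and "\<And>c v P. \<lbrakk>reachable_config I \<epsilon> \<delta> c; \<Phi> c; active c = Some v;
             selectable I (lengths c) v P;
             threshold (current_round c) \<le> path_length (lengths c) P\<rbrakk>
           \<Longrightarrow> \<Phi> (c\<lparr>active := None\<rparr>)"
  shows "\<Phi> c"
  using assms(1) unfolding reachable_config_def
proof (induction rule: rtranclp_induct)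
  case base
  then show ?case by (rule assms(2))
next
  case (step c d)
  have c: "reachable_config I \<epsilon> \<delta> c"
    using step.hyps(1) by (simp add: reachable_config_def)
  from step.hyps(2) show ?case
  proof cases
    case next_round
    then show ?thesis using assms(3)[OF c step.IH] by simp
  next
    case (enter_source v)
    then show ?thesis using assms(4)[OF c step.IH] by simp
  next
    case (augmentation v P)
    then show ?thesis
      using assms(5)[OF c step.IH _ _ selectable_in_all_paths] by (simp add: threshold_def)
  next
    case (leave_source v P)
    show ?thesis
      unfolding leave_source(1)
      by (rule assms(6)[OF c step.IH leave_source(2,3)])
         (use leave_source(4) in \<open>simp add: threshold_def not_less min_le_iff_disj\<close>)
  qed
qed

lemma lengths_ge:
  assumes "reachable_config I \<epsilon> \<delta> c"
  shows "\<delta> \<le> lengths c e"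
  using assms
proof (induction rule: reachable_induct)
  case (augment c v P)
  then show ?case
    using augment_lengths_ge[of P "lengths c" e] delta_pos by simp
qed (auto simp: initial_def)

lemma lengths_pos: "reachable_config I \<epsilon> \<delta> c \<Longrightarrow> 0 < lengths c e"
  using lengths_ge[of c e] delta_pos by linarith

text \<open>An augmented path is shorter than 1, hence so is each of its arcs, and one update
  multiplies by at most \<open>1 + \<epsilon>\<close>. The maximum allows for a
  \<open>\<delta>\<close> above \<open>1 + \<epsilon>\<close>.\<close>

lemma lengths_le:
  assumes "reachable_config I \<epsilon> \<delta> c"
  shows "lengths c e \<le> max \<delta> (1 + \<epsilon>)"
  using assms
proof (induction rule: reachable_induct)
  case (augment c v P)
  show ?case
  proof (cases "e \<in> set P")
    case True
    have "lengths c e \<le> path_length (lengths c) P"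
      unfolding path_length_def using True lengths_pos[OF augment.hyps(1)]
      by (intro member_le_sum) (auto intro: less_imp_le)
    also have "\<dots> \<le> 1"
      using augment by (simp add: threshold_def)
    finally have "lengths c e * (1 + \<epsilon> * capacity_ratio I P e) \<le> 1 * (1 + \<epsilon> * 1)"
      using capacity_ratio_bounds[OF augment.hyps(4) True] eps_pos lengths_pos[OF augment.hyps(1), of e]
      by (intro mult_mono add_mono) auto
    then show ?thesis
      using True by (simp add: augment_lengths_def)
  qed (use augment in \<open>simp add: augment_lengths_def\<close>)
qed (auto simp: initial_def)

lemma pending_active_sources:
  assumes "reachable_config I \<epsilon> \<delta> c"
  shows "pending c \<subseteq> sources I" and "active c = Some v \<Longrightarrow> v \<in> sources I"
proof -
  have "pending c \<subseteq> sources I \<and> (\<forall>v. active c = Some v \<longrightarrow> v \<in> sources I)"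
    using assms by (induction rule: reachable_induct) (auto simp: initial_def)
  then show "pending c \<subseteq> sources I" "active c = Some v \<Longrightarrow> v \<in> sources I"
    by auto
qed

lemma path_length_mono:
  "(\<And>e. l e \<le> l' e) \<Longrightarrow> path_length l P \<le> path_length l' P"
  unfolding path_length_def by (rule sum_mono)

lemma path_length_ge_threshold_0:
  assumes "P \<in> all_paths I" "\<And>e. \<delta> \<le> l e"
  shows "threshold 0 \<le> path_length l P"
proof -
  obtain e where e: "e \<in> set P"
    using all_pathsD(2)[OF assms(1)] by (cases P) auto
  have "\<delta> \<le> l e"
    by (rule assms(2))
  also have "\<dots> \<le> path_length l P"
    unfolding path_length_def using e assms(2) delta_pos
    by (intro member_le_sum) (auto intro: order_trans[of 0 \<delta>])
  finally show ?thesis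
    by (simp add: threshold_def)
qed

text \<open>Leaving a source certifies the current threshold for all its paths, and lengths never
  decrease. Sources not yet finished in this round retain the certificate of the previous
  one.\<close>

lemma path_length_ge_threshold:
  assumes "reachable_config I \<epsilon> \<delta> c"
    and "i \<in> {1..pairs I}" "R \<in> bounded_paths I (source I i) (sink I i)"
  shows "threshold (if source I i \<in> pending c \<or> active c = Some (source I i)
           then current_round c - 1 else current_round c) \<le> path_length (lengths c) R"
    (is "threshold (?r c) \<le> _")
  using assms(1)
proof (induction rule: reachable_induct)
  case initial
  then show ?case
    using path_length_ge_threshold_0[OF all_pathsI[OF assms(2) refl assms(3)], of "\<lambda>_. \<delta>"]
    by (simp add: initial_def)
next
  case (next_round c)
  then show ?case
    using assms(2) by (auto simp: sources_def)
next
  case (enter c v)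
  then show ?case
    by (auto split: if_splits)
next
  case (augment c v P)
  have "path_length (lengths c) R \<le> path_length (augment_lengths I \<epsilon> P (lengths c)) R"
    by (intro path_length_mono augment_lengths_ge augment less_imp_le lengths_pos)
  with augment show ?case
    by auto
next
  case (leave c v P)
  show ?case
  proof (cases "source I i = v")
    case True
    then have "threshold (current_round c) \<le> path_length (lengths c) R"
      using leave.hyps(4) selectable_le[OF leave.hyps(3) assms(2) True, of R] assms(3) by auto
    \<comment> \<open>The invariant does not record that an active source has left
      \<open>pending\<close>, so both branches of the \<open>if\<close> must be covered.\<close>
    moreover have "threshold (current_round c - 1) \<le> threshold (current_round c)"
      by (rule threshold_mono) simp
    ultimately show ?thesis
      by auto
  next
    case False
    then show ?thesis
      using leave.IH leave.hyps(2) by (auto split: if_splits)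
  qed
qed

lemma path_length_ge_previous_threshold:
  assumes "reachable_config I \<epsilon> \<delta> c" "R \<in> all_paths I"
  shows "threshold (current_round c - 1) \<le> path_length (lengths c) R"
proof -
  from assms(2) obtain i where
    i: "i \<in> {1..pairs I}" "R \<in> bounded_paths I (source I i) (sink I i)"
    unfolding all_paths_def by auto
  have "threshold (current_round c - 1) \<le> threshold (current_round c)"
    by (rule threshold_mono) simp
  with path_length_ge_threshold[OF assms(1) i] show ?thesis
    by (auto split: if_splits)
qed

text \<open>At completion no source is pending or active, so every path meets the final threshold,
  which is 1.\<close>

lemma completed_path_length_ge_1:
  assumes "reachable_config I \<epsilon> \<delta> c" "completed \<epsilon> \<delta> c" "R \<in> all_paths I"
  shows "1 \<le> path_length (lengths c) R"
proof -
  from assms(3) obtain i where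
    i: "i \<in> {1..pairs I}" "R \<in> bounded_paths I (source I i) (sink I i)"
    unfolding all_paths_def by auto
  show ?thesis
    using path_length_ge_threshold[OF assms(1) i] assms(2) threshold_eq_1
    by (simp add: completed_def)
qed

section \<open>Number of augmentations and termination\<close>

text \<open>The right-hand side is a potential: each augmentation raises the term of a bottleneck
  arc by exactly 1 and lowers no other term.\<close>

lemma augmentations_le_sum_log:
  assumes "reachable_config I \<epsilon> \<delta> c"
  shows "real (augmentations c) \<le> (\<Sum>e\<in>E. log (1 + \<epsilon>) (lengths c e / \<delta>))"
  using assms
proof (induction rule: reachable_induct)
  case (augment c v P)
  let ?l = "lengths c" and ?l' = "augment_lengths I \<epsilon> P (lengths c)"
  obtain b where b: "b \<in> set P" "capacity I b = bottleneck I P"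
    by (rule bottleneck_attained[OF augment.hyps(4)])
  have bE: "b \<in> E"
    using b all_pathsD(1)[OF augment.hyps(4)] by auto
  have "log (1 + \<epsilon>) (?l' b / \<delta>) = log (1 + \<epsilon>) (?l b / \<delta>) + 1"
    using log_augment_lengths[OF augment.hyps(4) b(1) lengths_pos[OF augment.hyps(1)]] b(2) eps_pos
    by (simp add: capacity_ratio_def)
  moreover have "(\<Sum>e\<in>E - {b}. log (1 + \<epsilon>) (?l e / \<delta>)) \<le> (\<Sum>e\<in>E - {b}. log (1 + \<epsilon>) (?l' e / \<delta>))"
  proof (rule sum_mono)
    fix e
    have l: "0 < ?l e"
      by (rule lengths_pos[OF augment.hyps(1)])
    have "?l e \<le> ?l' e"
      using l by (intro augment_lengths_ge augment) simp
    then show "log (1 + \<epsilon>) (?l e / \<delta>) \<le> log (1 + \<epsilon>) (?l' e / \<delta>)"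
      using l delta_pos eps_pos by (intro log_mono divide_right_mono) auto
  qed
  ultimately show ?case
    using augment.IH bE by (simp add: sum.remove)
qed (use delta_pos in \<open>auto simp: initial_def\<close>)

lemma augmentations_le:
  assumes "reachable_config I \<epsilon> \<delta> c"
  shows "real (augmentations c) \<le> \<bar>real (card E) * K\<bar>"
proof -
  have "log (1 + \<epsilon>) (lengths c e / \<delta>) \<le> \<bar>K\<bar>" for e
  proof -
    have "log (1 + \<epsilon>) (lengths c e / \<delta>) \<le> log (1 + \<epsilon>) (max \<delta> (1 + \<epsilon>) / \<delta>)"
      using lengths_le[OF assms, of e] lengths_pos[OF assms, of e] delta_pos eps_pos
      by (intro log_mono divide_right_mono) auto
    \<comment> \<open>If the maximum is \<open>\<delta>\<close>, the logarithm is 0, while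
      \<open>K\<close> may be negative; otherwise it is \<open>K\<close>.\<close>
    also have "\<dots> \<le> \<bar>K\<bar>"
      using delta_pos by (auto simp: max_def)
    finally show ?thesis .
  qed
  then have "(\<Sum>e\<in>E. log (1 + \<epsilon>) (lengths c e / \<delta>)) \<le> real (card E) * \<bar>K\<bar>"
    by (rule sum_bounded_above)
  with augmentations_le_sum_log[OF assms] show ?thesis
    by (simp add: abs_mult)
qed

lemma no_infinite_run:
  "\<nexists>c. c 0 = initial \<delta> \<and> (\<forall>j::nat. step I \<epsilon> \<delta> (c j) (c (Suc j)))"
proof
  assume "\<exists>c. c 0 = initial \<delta> \<and> (\<forall>j::nat. step I \<epsilon> \<delta> (c j) (c (Suc j)))"
  then obtain c where c: "c 0 = initial \<delta>" "\<And>j::nat. step I \<epsilon> \<delta> (c j) (c (Suc j))"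
    by blast
  have reach: "reachable_config I \<epsilon> \<delta> (c j)" for j
    unfolding reachable_config_def
    by (induction j) (auto simp: c(1) intro: rtranclp.rtrancl_into_rtrancl c(2))
  define N where "N = nat \<lfloor>\<bar>real (card E) * K\<bar>\<rfloor>"
  have N: "augmentations (c j) \<le> N" for j
    using augmentations_le[OF reach, of j] by (simp add: N_def le_nat_floor)
  have fin: "finite (pending (c j))" for j
    using pending_active_sources(1)[OF reach, of j]
    by (rule finite_subset) (simp add: sources_def)
  \<comment> \<open>Lexicographic order, one component for each kind of step: a new round refills
    \<open>pending\<close> but uses up a round, entering a source sets the active flag but shrinks
    \<open>pending\<close>, leaving clears the flag, and an augmentation changes only the last
    component.\<close>
  let ?M = "measures [\<lambda>c. nat (max_round \<epsilon> \<delta>) - current_round c, \<lambda>c. card (pending c),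
    \<lambda>c. if active c = None then 0 else 1, \<lambda>c. N - augmentations c]"
  have "(c (Suc j), c j) \<in> ?M" for j
    using c(2)[of j]
  proof cases
    case next_round
    then have "nat (max_round \<epsilon> \<delta>) - current_round (c (Suc j))
        < nat (max_round \<epsilon> \<delta>) - current_round (c j)"
      by simp
    then show ?thesis by simp
  next
    case (enter_source v)
    then show ?thesis
      using card_Diff1_less[OF fin] by simp
  next
    case (augmentation v P)
    \<comment> \<open>The bound \<open>N\<close> after the step ensures that the truncated
      difference strictly decreases.\<close>
    then show ?thesis
      using N[of "Suc j"] by simp
  next
    case (leave_source v P)
    then show ?thesis by simp
  qed
  moreover have "wf ?M"
    by (rule wf_measures)
  ultimately show False
    unfolding wf_iff_no_infinite_down_chain by blast
qed

lemma completed_or_step: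
  assumes "reachable_config I \<epsilon> \<delta> c"
  shows "completed \<epsilon> \<delta> c \<or> (\<exists>d. step I \<epsilon> \<delta> c d)"
proof (cases "active c")
  case None
  show ?thesis
  proof (cases "pending c = {}")
    case True
    with None show ?thesis
      using step.next_round[of c \<epsilon> \<delta> I] by (fastforce simp: completed_def)
  next
    case False
    with None show ?thesis
      by (meson all_not_in_conv step.enter_source)
  qed
next
  case (Some v)
  then obtain P where P: "selectable I (lengths c) v P"
    using ex_selectable pending_active_sources(2)[OF assms] by blast
  show ?thesis
    using step.augmentation[OF Some P] step.leave_source[OF Some P] by blast
qed

lemma always_completes: "always_completes I \<epsilon> \<delta>"
  unfolding always_completes_def using no_infinite_run completed_or_step by blast

section \<open>Feasibility of the computed flow\<close>

lemma flow_nonneg: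
  assumes "reachable_config I \<epsilon> \<delta> c" "0 < K"
  shows "0 \<le> flow c R"
  using assms(1)
proof (induction rule: reachable_induct)
  case (augment c v P)
  then show ?case
    using bottleneck_nonneg assms(2) by (auto simp: augment_flow_def)
qed (auto simp: initial_def)

text \<open>With \<open>t\<close> the capacity ratio, an augmentation through \<open>e\<close> adds
  \<open>capacity I e * t\<close> on the left and
  \<open>capacity I e * log (1 + \<epsilon>) (1 + \<epsilon> * t)\<close> on the right, which is no
  less by \<open>le_log_one_plus\<close>.\<close>

lemma arc_flow_le_log:
  assumes "reachable_config I \<epsilon> \<delta> c" "e \<in> E" "0 < K"
  shows "K * (\<Sum>P\<in>{P \<in> all_paths I. e \<in> set P}. flow c P)
       \<le> capacity I e * log (1 + \<epsilon>) (lengths c e / \<delta>)"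
  using assms(1)
proof (induction rule: reachable_induct)
  case (augment c v P)
  let ?A = "{P \<in> all_paths I. e \<in> set P}" and ?l = "lengths c"
  have sum: "(\<Sum>R\<in>?A. augment_flow I \<epsilon> \<delta> P (flow c) R)
      = (\<Sum>R\<in>?A. flow c R) + (if e \<in> set P then bottleneck I P / K else 0)"
  proof -
    have "augment_flow I \<epsilon> \<delta> P (flow c) R = flow c R + (if P = R then bottleneck I P / K else 0)" for R
      by (simp add: augment_flow_def)
    then show ?thesis
      using augment.hyps(4) finite_all_paths by (simp add: sum.distrib sum.delta)
  qed
  show ?case
  proof (cases "e \<in> set P")
    case True
    let ?t = "capacity_ratio I P e"
    have "bottleneck I P = capacity I e * ?t"
      using capacity_times_ratio[OF augment.hyps(4) True] by simp
    also have "\<dots> \<le> capacity I e * log (1 + \<epsilon>) (1 + \<epsilon> * ?t)"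
      using capacity_ratio_bounds[OF augment.hyps(4) True] eps_pos capacity_nonneg[OF assms(2)]
      by (intro mult_left_mono le_log_one_plus) auto
    finally show ?thesis
      using True augment.IH assms(3) log_augment_lengths[OF augment.hyps(4) True lengths_pos[OF augment.hyps(1)]]
      by (simp add: sum distrib_left)
  next
    case False
    then show ?thesis
      using augment.IH sum by (simp add: augment_lengths_def)
  qed
qed (use delta_pos in \<open>auto simp: initial_def\<close>)

text \<open>The bound \<open>\<delta> \<le> 1\<close> makes \<open>K\<close> positive and the length
  bound \<open>1 + \<epsilon>\<close>, so the logarithm in \<open>arc_flow_le_log\<close> is at most
  \<open>K\<close>, which then cancels.\<close>

lemma feasible_flow:
  assumes "reachable_config I \<epsilon> \<delta> c" "\<delta> \<le> 1"
  shows "feasible I (flow c)"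
proof -
  have K: "0 < K"
    using assms(2) eps_pos delta_pos by simp
  have "(\<Sum>P\<in>{P \<in> all_paths I. e \<in> set P}. flow c P) \<le> capacity I e" if e: "e \<in> E" for e
  proof -
    have "log (1 + \<epsilon>) (lengths c e / \<delta>) \<le> K"
      using lengths_le[OF assms(1), of e] lengths_pos[OF assms(1), of e] assms(2) eps_pos delta_pos
      by (intro log_mono divide_right_mono) auto
    then have "capacity I e * log (1 + \<epsilon>) (lengths c e / \<delta>) \<le> capacity I e * K"
      using capacity_nonneg[OF e] by (rule mult_left_mono)
    with arc_flow_le_log[OF assms(1) e K]
    have "K * (\<Sum>P\<in>{P \<in> all_paths I. e \<in> set P}. flow c P) \<le> K * capacity I e"
      by (simp add: mult.commute)
    then show ?thesis
      using K by simp
  qed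
  then show ?thesis
    using flow_nonneg[OF assms(1) K] by (simp add: feasible_def)
qed

section \<open>Weak LP duality\<close>

text \<open>The objective of the dual program, in which arc lengths are the variables.\<close>

definition volume :: "('b \<Rightarrow> real) \<Rightarrow> real" where
  "volume l = (\<Sum>e\<in>E. capacity I e * l e)"

text \<open>Double counting over paths and arcs with the nonnegative weights
  \<open>l - \<delta>\<close>. A path has at most \<open>max_edges I\<close> arcs, so subtracting
  \<open>\<delta>\<close> from each costs it at most \<open>\<delta> * max_edges I\<close>.\<close>

lemma weak_duality:
  assumes "feasible I y" "\<And>e. \<delta> \<le> l e" "\<And>P. P \<in> all_paths I \<Longrightarrow> \<tau> \<le> path_length l P"
  shows "(\<tau> - \<delta> * max_edges I) * flow_value I y \<le> volume l - volume (\<lambda>_. \<delta>)"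
proof -
  let ?d = "\<lambda>e. l e - \<delta>"
  have "(\<tau> - \<delta> * max_edges I) * flow_value I y
      = (\<Sum>P\<in>all_paths I. (\<tau> - \<delta> * max_edges I) * y P)"
    by (simp add: flow_value_def sum_distrib_left)
  also have "\<dots> \<le> (\<Sum>P\<in>all_paths I. (\<Sum>e\<in>set P. ?d e) * y P)"
  proof (intro sum_mono mult_right_mono)
    fix P assume P: "P \<in> all_paths I"
    show "0 \<le> y P"
      using assms(1) P by (simp add: feasible_def)
    have "real (card (set P)) \<le> max_edges I"
      using card_length[of P] all_pathsD(3)[OF P] by linarith
    then have "\<delta> * real (card (set P)) \<le> \<delta> * max_edges I"
      using delta_pos by simp
    then show "\<tau> - \<delta> * max_edges I \<le> (\<Sum>e\<in>set P. ?d e)"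
      using assms(3)[OF P] by (simp add: sum_subtractf path_length_def mult.commute)
  qed
  also have "\<dots> = (\<Sum>P\<in>all_paths I. \<Sum>e\<in>E. if e \<in> set P then ?d e * y P else 0)"
  proof (rule sum.cong[OF refl])
    fix P assume "P \<in> all_paths I"
    then have "{e \<in> E. e \<in> set P} = set P"
      using all_pathsD(1) by auto
    then show "(\<Sum>e\<in>set P. ?d e) * y P = (\<Sum>e\<in>E. if e \<in> set P then ?d e * y P else 0)"
      by (simp add: sum_distrib_right sum.If_cases Int_def)
  qed
  also have "\<dots> = (\<Sum>e\<in>E. \<Sum>P\<in>all_paths I. if e \<in> set P then ?d e * y P else 0)"
    by (rule sum.swap)
  also have "\<dots> = (\<Sum>e\<in>E. ?d e * (\<Sum>P\<in>{P \<in> all_paths I. e \<in> set P}. y P))"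
    by (simp add: sum_distrib_left sum.If_cases finite_all_paths Int_def)
  also have "\<dots> \<le> (\<Sum>e\<in>E. ?d e * capacity I e)"
    using assms(1,2) by (intro sum_mono mult_left_mono) (auto simp: feasible_def)
  also have "\<dots> = volume l - volume (\<lambda>_. \<delta>)"
    by (simp add: volume_def sum_subtractf algebra_simps)
  finally show ?thesis .
qed

lemma feasible_zero: "feasible I (\<lambda>_. 0)"
  using capacity_nonneg by (simp add: feasible_def)

lemma bdd_above_flow_value: "bdd_above (flow_value I ` {x. feasible I x})"
proof (rule bdd_aboveI2)
  fix x assume x: "x \<in> {x. feasible I x}"
  \<comment> \<open>This \<open>?\<tau>\<close> makes the factor in \<open>weak_duality\<close>
    equal to 1; paths are nonempty, so the constant length \<open>?l\<close> suffices.\<close>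
  let ?\<tau> = "1 + \<delta> * max_edges I" and ?l = "\<lambda>_::'b. 1 + \<delta> * max_edges I + \<delta>"
  have "?\<tau> \<le> path_length ?l P" if "P \<in> all_paths I" for P
  proof -
    have "1 \<le> card (set P)"
      using all_pathsD(2)[OF that] by (simp add: Suc_le_eq card_gt_0_iff)
    then have "1 * (?\<tau> + \<delta>) \<le> card (set P) * (?\<tau> + \<delta>)"
      using delta_pos by (intro mult_right_mono) auto
    then show ?thesis
      using delta_pos by (simp add: path_length_def)
  qed
  then show "flow_value I x \<le> volume ?l - volume (\<lambda>_. \<delta>)"
    using weak_duality[of x ?l ?\<tau>] x delta_pos by simp
qed

lemma flow_value_le_optimal: "feasible I x \<Longrightarrow> flow_value I x \<le> optimal_value I"
  unfolding optimal_value_def by (rule cSUP_upper[OF _ bdd_above_flow_value]) simp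

lemma optimal_value_nonneg: "0 \<le> optimal_value I"
  using flow_value_le_optimal[OF feasible_zero] by (simp add: flow_value_def)

text \<open>With a positive factor, divide and pass to the supremum, so no optimal solution has to
  be exhibited; otherwise the two sides have opposite signs.\<close>

lemma optimal_weak_duality:
  assumes "\<And>e. \<delta> \<le> l e" "\<And>P. P \<in> all_paths I \<Longrightarrow> \<tau> \<le> path_length l P"
  shows "(\<tau> - \<delta> * max_edges I) * optimal_value I \<le> volume l - volume (\<lambda>_. \<delta>)"
proof (cases "\<tau> \<le> \<delta> * max_edges I")
  case True
  have "volume (\<lambda>_. \<delta>) \<le> volume l"
    unfolding volume_def by (intro sum_mono mult_left_mono assms capacity_nonneg)
  moreover have "(\<tau> - \<delta> * max_edges I) * optimal_value I \<le> 0"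
    using True optimal_value_nonneg by (simp add: mult_nonpos_nonneg)
  ultimately show ?thesis by linarith
next
  case False
  have "optimal_value I \<le> (volume l - volume (\<lambda>_. \<delta>)) / (\<tau> - \<delta> * max_edges I)"
    unfolding optimal_value_def
  proof (rule cSUP_least)
    show "{x. feasible I x} \<noteq> {}"
      using feasible_zero by auto
    show "flow_value I y \<le> (volume l - volume (\<lambda>_. \<delta>)) / (\<tau> - \<delta> * max_edges I)"
      if "y \<in> {x. feasible I x}" for y
      using weak_duality[OF _ assms, of y] that False by (simp add: field_simps)
  qed
  with False show ?thesis
    by (simp add: field_simps)
qed

section \<open>Growth of the volume and the approximation guarantee\<close>

lemma volume_augment:
  assumes "P \<in> all_paths I"
  shows "volume (augment_lengths I \<epsilon> P l) = volume l + \<epsilon> * bottleneck I P * path_length l P"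
proof -
  have "volume (augment_lengths I \<epsilon> P l)
      = (\<Sum>e\<in>E. capacity I e * l e + (if e \<in> set P then \<epsilon> * bottleneck I P * l e else 0))"
    unfolding volume_def
    by (rule sum.cong)
       (auto simp: augment_lengths_def algebra_simps simp flip: capacity_times_ratio[OF assms])
  also have "\<dots> = volume l + (\<Sum>e\<in>{e \<in> E. e \<in> set P}. \<epsilon> * bottleneck I P * l e)"
    by (simp add: volume_def sum.distrib sum.If_cases Int_def)
  also have "{e \<in> E. e \<in> set P} = set P"
    using all_pathsD(1)[OF assms] by auto
  finally show ?thesis
    by (simp add: path_length_def sum_distrib_left)
qed

lemma flow_value_augment:
  assumes "P \<in> all_paths I"
  shows "flow_value I (augment_flow I \<epsilon> \<delta> P x) = flow_value I x + bottleneck I P / K"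
proof -
  have "augment_flow I \<epsilon> \<delta> P x R = x R + (if P = R then bottleneck I P / K else 0)" for R
    by (simp add: augment_flow_def)
  then show ?thesis
    using assms finite_all_paths by (simp add: flow_value_def sum.distrib)
qed

text \<open>By weak duality applied to the length increases \<open>l - \<delta>\<close>, the left-hand side bounds the
  minimum length of a path from above. Hence an augmentation along \<open>P\<close>, where \<open>P\<close> is a shortest
  path up to a factor \<open>1 + \<epsilon>\<close>, multiplies it by at most
  \<open>1 + \<epsilon> * (1 + \<epsilon>) * bottleneck I P / optimal_value I\<close>.\<close>

lemma volume_le_exp:
  assumes "reachable_config I \<epsilon> \<delta> c" "0 < K" "0 < optimal_value I"
  shows "\<delta> * max_edges I + (volume (lengths c) - volume (\<lambda>_. \<delta>)) / optimal_value I
       \<le> \<delta> * max_edges I * exp (\<epsilon> * (1 + \<epsilon>) * K * flow_value I (flow c) / optimal_value I)"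
  using assms(1)
proof (induction rule: reachable_induct)
  case (augment c v P)
  let ?f = "optimal_value I" and ?l = "lengths c" and ?u = "bottleneck I P"
  let ?W = "\<delta> * max_edges I + (volume ?l - volume (\<lambda>_. \<delta>)) / ?f"
  let ?\<tau> = "threshold (current_round c - 1)"
  let ?B = "\<lambda>g. \<delta> * max_edges I * exp (\<epsilon> * (1 + \<epsilon>) * K * g / ?f)"
  have u: "0 \<le> ?u"
    by (rule bottleneck_nonneg[OF augment.hyps(4)])
  have "(?\<tau> - \<delta> * max_edges I) * ?f \<le> volume ?l - volume (\<lambda>_. \<delta>)"
    using lengths_ge[OF augment.hyps(1)] path_length_ge_previous_threshold[OF augment.hyps(1)]
    by (rule optimal_weak_duality)
  then have "?\<tau> \<le> ?W"
    using assms(3) by (simp add: field_simps)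
  \<comment> \<open>An augmented path lies below the current threshold, which is at most
    \<open>1 + \<epsilon>\<close> times the previous one, and \<open>?W\<close> dominates the latter
    by duality.\<close>
  then have P: "path_length ?l P \<le> (1 + \<epsilon>) * ?W"
    using augment.hyps(5) threshold_le[of "current_round c"] eps_pos
      mult_left_mono[of ?\<tau> ?W "1 + \<epsilon>"] by linarith
  have factor: "w + \<epsilon> * ?u / ?f * ((1 + \<epsilon>) * w) = w * (1 + \<epsilon> * (1 + \<epsilon>) * ?u / ?f)" for w
    by (simp add: algebra_simps add_divide_distrib)
  have "\<delta> * max_edges I + (volume (augment_lengths I \<epsilon> P ?l) - volume (\<lambda>_. \<delta>)) / ?f
      = ?W + \<epsilon> * ?u / ?f * path_length ?l P"
    by (simp add: volume_augment[OF augment.hyps(4)] add_divide_distrib diff_divide_distrib)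
  also have "\<dots> \<le> ?W + \<epsilon> * ?u / ?f * ((1 + \<epsilon>) * ?W)"
    using P u eps_pos assms(3) by (intro add_left_mono mult_left_mono) auto
  also have "\<dots> = ?W * (1 + \<epsilon> * (1 + \<epsilon>) * ?u / ?f)"
    by (rule factor)
  also have "\<dots> \<le> ?B (flow_value I (flow c)) * exp (\<epsilon> * (1 + \<epsilon>) * ?u / ?f)"
    using augment.IH u eps_pos assms(3) delta_pos
    by (intro mult_mono exp_ge_add_one_self) auto
  \<comment> \<open>The factor \<open>K\<close> in the exponent undoes the scaling of the
    flow.\<close>
  also have "\<dots> = ?B (flow_value I (flow c) + ?u / K)"
    using assms(2,3) by (simp add: mult_exp_exp distrib_left add_divide_distrib)
  also have "\<dots> = ?B (flow_value I (augment_flow I \<epsilon> \<delta> P (flow c)))"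
    using flow_value_augment[OF augment.hyps(4)] by simp
  finally show ?case
    by simp
qed (simp_all add: initial_def flow_value_def)

lemma completed_exp_ge_1:
  assumes "reachable_config I \<epsilon> \<delta> c" "completed \<epsilon> \<delta> c" "0 < K" "0 < optimal_value I"
  shows "1 \<le> \<delta> * max_edges I * exp (\<epsilon> * (1 + \<epsilon>) * K * flow_value I (flow c) / optimal_value I)"
proof -
  have "(1 - \<delta> * max_edges I) * optimal_value I \<le> volume (lengths c) - volume (\<lambda>_. \<delta>)"
    using lengths_ge[OF assms(1)] completed_path_length_ge_1[OF assms(1,2)]
    by (rule optimal_weak_duality)
  then have "1 \<le> \<delta> * max_edges I + (volume (lengths c) - volume (\<lambda>_. \<delta>)) / optimal_value I"
    using assms(4) by (simp add: field_simps)
  also note volume_le_exp[OF assms(1,3,4)]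
  finally show ?thesis .
qed

text \<open>The choice of \<open>\<delta>\<close> makes both \<open>K\<close> and
  \<open>ln (\<delta> * L)\<close> multiples of \<open>M\<close>, so taking logarithms in
  \<open>completed_exp_ge_1\<close> and cancelling \<open>M\<close> leaves an inequality in
  \<open>\<epsilon>\<close>, the flow value and the optimum alone.\<close>

lemma approximation:
  assumes eps: "\<epsilon> \<le> 1"
    and delta: "\<delta> = (1 + \<epsilon>) / ((1 + \<epsilon>) * real (max_edges I)) powr (1 / \<epsilon>)"
    and c: "reachable_config I \<epsilon> \<delta> c" "completed \<epsilon> \<delta> c"
  shows "feasible I (flow c)"
    and "optimal_value I * (1 - \<epsilon>)\<^sup>2 / (1 + \<epsilon>) \<le> flow_value I (flow c)"
proof -
  let ?L = "real (max_edges I)" and ?f = "optimal_value I" and ?g = "flow_value I (flow c)"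
  define M where "M = ln ((1 + \<epsilon>) * ?L)"
  have L: "1 \<le> ?L"
    using inst by (simp add: lbmcf_instance_def)
  have base: "1 + \<epsilon> \<le> (1 + \<epsilon>) * ?L"
    using L eps_pos by simp
  have M: "0 < M"
    unfolding M_def using base eps_pos by (intro ln_gt_zero) linarith
  have ratio: "(1 + \<epsilon>) / \<delta> = ((1 + \<epsilon>) * ?L) powr (1 / \<epsilon>)"
    using eps_pos base unfolding delta by simp
  \<comment> \<open>Here \<open>\<epsilon> \<le> 1\<close> gives an exponent
    \<open>1 / \<epsilon>\<close> of at least 1, whence \<open>\<delta> \<le> 1\<close>.\<close>
  have "(1 + \<epsilon>) powr 1 \<le> ((1 + \<epsilon>) * ?L) powr (1 / \<epsilon>)"
    using eps_pos eps base by (intro powr_mono_both) auto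
  then have delta_le: "\<delta> \<le> 1"
    using eps_pos delta_pos unfolding ratio[symmetric] by (simp add: divide_simps)
  then have K: "0 < K"
    using eps_pos delta_pos by simp
  have "ln ((1 + \<epsilon>) / \<delta>) = M / \<epsilon>"
    unfolding ratio M_def using base eps_pos by (simp add: ln_powr)
  then have K_eq: "K = M / (\<epsilon> * ln (1 + \<epsilon>))"
    by (simp add: log_def)
  have ln_delta: "ln (\<delta> * ?L) = M - M / \<epsilon>"
    using \<open>ln ((1 + \<epsilon>) / \<delta>) = M / \<epsilon>\<close> L eps_pos delta_pos
    by (simp add: M_def ln_mult ln_div)
  show feas: "feasible I (flow c)"
    using c(1) delta_le by (rule feasible_flow)
  have g: "0 \<le> ?g"
    using feas by (auto simp: feasible_def flow_value_def intro: sum_nonneg)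
  show "?f * (1 - \<epsilon>)\<^sup>2 / (1 + \<epsilon>) \<le> ?g"
  proof (cases "?f = 0")
    case True
    then show ?thesis using g by simp
  next
    case False
    then have f: "0 < ?f"
      using optimal_value_nonneg by simp
    have lnpos: "0 < ln (1 + \<epsilon>)"
      using eps_pos by simp
    have "0 \<le> ln (\<delta> * ?L * exp (\<epsilon> * (1 + \<epsilon>) * K * ?g / ?f))"
      using completed_exp_ge_1[OF c K f] by (rule ln_ge_zero)
    also have "\<dots> = M - M / \<epsilon> + \<epsilon> * (1 + \<epsilon>) * K * ?g / ?f"
      using delta_pos L by (subst ln_mult) (auto simp: ln_delta)
    also have "\<dots> = M * ((1 + \<epsilon>) * ?g / (ln (1 + \<epsilon>) * ?f) - (1 - \<epsilon>) / \<epsilon>)"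
      unfolding K_eq using eps_pos lnpos f by (simp add: field_simps)
    finally have "(1 - \<epsilon>) / \<epsilon> \<le> (1 + \<epsilon>) * ?g / (ln (1 + \<epsilon>) * ?f)"
      using M by (simp add: zero_le_mult_iff)
    then have "(1 - \<epsilon>) * (?f * ln (1 + \<epsilon>)) \<le> \<epsilon> * ((1 + \<epsilon>) * ?g)"
      using eps_pos lnpos f by (simp add: field_simps)
    \<comment> \<open>The second factor \<open>1 - \<epsilon>\<close> comes from
      \<open>ln (1 + \<epsilon>) \<ge> \<epsilon> - \<epsilon>\<^sup>2\<close>.\<close>
    moreover have "(1 - \<epsilon>) * (?f * (\<epsilon> * (1 - \<epsilon>))) \<le> (1 - \<epsilon>) * (?f * ln (1 + \<epsilon>))"
      using ln_one_plus_pos_lower_bound[of \<epsilon>] eps_pos f eps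
      by (intro mult_left_mono) (auto simp: power2_eq_square algebra_simps)
    ultimately have "\<epsilon> * (?f * (1 - \<epsilon>)\<^sup>2) \<le> \<epsilon> * ((1 + \<epsilon>) * ?g)"
      by (simp add: power2_eq_square algebra_simps)
    then have "?f * (1 - \<epsilon>)\<^sup>2 \<le> (1 + \<epsilon>) * ?g"
      using eps_pos by simp
    then show ?thesis
      using eps_pos by (simp add: field_simps)
  qed
qed

end

theorem theorem1:
  shows
    "(\<exists>C>0. \<forall>(I :: ('a, 'b) lbmcf) (\<epsilon> :: real) (\<delta> :: real).
        lbmcf_instance I \<and> 0 < \<epsilon> \<and> 0 < \<delta> \<longrightarrow>
          always_completes I \<epsilon> \<delta> \<and>
          (\<forall>c. reachable_config I \<epsilon> \<delta> c \<and> completed \<epsilon> \<delta> c \<longrightarrow>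
             real (augmentations c)
               \<le> C * \<bar>real (card (arcs (network I))) * log (1 + \<epsilon>) ((1 + \<epsilon>) / \<delta>)\<bar>)) \<and>
     (\<forall>(I :: ('a, 'b) lbmcf) (\<epsilon> :: real) (\<delta> :: real) c.
        lbmcf_instance I \<and> 0 < \<epsilon> \<and> \<epsilon> \<le> 1 \<and>
        \<delta> = (1 + \<epsilon>) / ((1 + \<epsilon>) * real (max_edges I)) powr (1 / \<epsilon>) \<and>
        reachable_config I \<epsilon> \<delta> c \<and> completed \<epsilon> \<delta> c \<longrightarrow>
          feasible I (flow c) \<and>
          flow_value I (flow c) \<ge> optimal_value I * (1 - \<epsilon>)\<^sup>2 / (1 + \<epsilon>))"
proof -
  have "always_completes I \<epsilon> \<delta> \<and>
      (\<forall>c. reachable_config I \<epsilon> \<delta> c \<and> completed \<epsilon> \<delta> c \<longrightarrow>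
         real (augmentations c)
           \<le> 1 * \<bar>real (card (arcs (network I))) * log (1 + \<epsilon>) ((1 + \<epsilon>) / \<delta>)\<bar>)"
    if "lbmcf_instance I \<and> 0 < \<epsilon> \<and> 0 < \<delta>" for I :: "('a, 'b) lbmcf" and \<epsilon> \<delta> :: real
  proof -
    interpret lbmcf_algorithm I \<epsilon> \<delta>
      using that by unfold_locales auto
    show ?thesis
      using always_completes augmentations_le by simp
  qed
  moreover have "feasible I (flow c) \<and>
      flow_value I (flow c) \<ge> optimal_value I * (1 - \<epsilon>)\<^sup>2 / (1 + \<epsilon>)"
    if "lbmcf_instance I \<and> 0 < \<epsilon> \<and> \<epsilon> \<le> 1 \<and>
        \<delta> = (1 + \<epsilon>) / ((1 + \<epsilon>) * real (max_edges I)) powr (1 / \<epsilon>) \<and>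
        reachable_config I \<epsilon> \<delta> c \<and> completed \<epsilon> \<delta> c"
    for I :: "('a, 'b) lbmcf" and \<epsilon> \<delta> :: real and c
  proof -
    \<comment> \<open>Makes the base of \<open>powr\<close> nonzero, hence \<open>\<delta>\<close>
      positive as the locale requires.\<close>
    have "0 < max_edges I"
      using that by (simp add: lbmcf_instance_def)
    then interpret lbmcf_algorithm I \<epsilon> \<delta>
      using that by unfold_locales auto
    show ?thesis
      using approximation that by blast
  qed
  ultimately show ?thesis
    by (intro conjI exI[of _ 1]) (simp, blast, blast)
qed

end
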